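(* Let $S$ be an Arf numerical semigroup with multiplicity $5$ and conductor $s\ge 5$. If $s\equiv 0\bmod 5$ and $S=\langle 5,s+1,s+2,s+3,s+4\rangle$, then $\mathrm{PF}(S)=\{s-4,s-3,s-2,s-1\}$, and the row-factorization matrices are exactly the following $5\times5$ matrices, described by their rows $r_1,\dots,r_5$ in order (where alternatives for different rows are chosen independently). For $s-4$ (one matrix): $r_1=(-1,1,0,0,0)$, $r_2=(\frac{s-5}{5},-1,1,0,0)$, $r_3=(\frac{s-5}{5},0,-1,1,0)$, $r_4=(\frac{s-5}{5},0,0,-1,1)$, $r_5=(\frac{2s}{5},0,0,0,-1)$. For $s-3$ (one matrix): $r_1=(-1,0,1,0,0)$, $r_2=(\frac{s-5}{5},-1,0,1,0)$, $r_3=(\frac{s-5}{5},0,-1,0,1)$, $r_4=(\frac{2s}{5},0,0,-1,0)$, $r_5=(\frac{s}{5},1,0,0,-1)$. For $s-2$ (two matrices): $r_1=(-1,0,0,1,0)$, $r_2=(\frac{s-5}{5},-1,0,0,1)$, $r_3=(\frac{2s}{5},0,-1,0,0)$, $r_4=(\frac{s}{5},1,0,-1,0)$, and $r_5=(\frac{s}{5},0,1,0,-1)$ or $r_5=(0,2,0,0,-1)$. For $s-1$ (four matrices): $r_1=(-1,0,0,0,1)$, $r_2=(\frac{2s}{5},-1,0,0,0)$, $r_3=(\frac{s}{5},1,-1,0,0)$, $r_4=(\frac{s}{5},0,1,-1,0)$ or $r_4=(0,2,0,-1,0)$, and $r_5=(\frac{s}{5},0,0,1,-1)$ or $r_5=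(0,1,1,0,-1)$.
   Context: A numerical semigroup is a subset $S\subseteq\mathbb{N}_0$ (non-negative integers) containing $0$, closed under addition, with finite complement in $\mathbb{N}_0$; $\langle A\rangle$ is the set of $\mathbb{N}_0$-linear combinations of elements of $A$. The multiplicity is the smallest nonzero element of $S$; the conductor is one plus the greatest integer not in $S$. $S$ is Arf if $s_2+s_3-s_1\in S$ for all $s_1\le s_2\le s_3$ in $S$. $\mathrm{PF}(S)$ is the set of integers $z\notin S$ with $z+x\in S$ for all nonzero $x\in S$. If $n_1<\dots<n_e$ are the minimal generators of $S$, a row-factorization matrix of $f\in\mathrm{PF}(S)$ is an $e\times e$ integer matrix $[a_{ij}]$ with $a_{ii}=-1$, $a_{ij}\in\mathbb{N}_0$ for $i\ne j$, and $f=\sum_{j=1}^e a_{ij}n_j$ for each $i$. *)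

theory Defs
  imports Main "Jordan_Normal_Form.Matrix"
begin

definition numerical_semigroup :: "nat set \<Rightarrow> bool" where
  "numerical_semigroup S \<longleftrightarrow>
     0 \<in> S \<and> (\<forall>x\<in>S. \<forall>y\<in>S. x + y \<in> S) \<and> finite (UNIV - S)"

definition generated :: "nat set \<Rightarrow> nat set" where
  "generated A = {\<Sum>a\<in>F. c a * a | F c. finite F \<and> F \<subseteq> A}"

definition semigroup_multiplicity :: "nat set \<Rightarrow> nat" where
  "semigroup_multiplicity S = (LEAST n. n \<in> S \<and> n \<noteq> 0)"

text \<open>The greatest element is taken over the integers, so that the conductor of the full
  semigroup of natural numbers is 0.\<close>

definition conductor :: "nat set \<Rightarrow> int" where
  "conductor S = 1 + (GREATEST z :: int. z \<notin> int ` S)"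

text \<open>The natural-number subtraction below does not truncate, because \<open>s1 \<le> s2\<close>.\<close>

definition arf :: "nat set \<Rightarrow> bool" where
  "arf S \<longleftrightarrow>
     (\<forall>s1\<in>S. \<forall>s2\<in>S. \<forall>s3\<in>S. s1 \<le> s2 \<and> s2 \<le> s3 \<longrightarrow> s2 + s3 - s1 \<in> S)"

definition pseudo_frobenius :: "nat set \<Rightarrow> int set" where
  "pseudo_frobenius S =
     {z. z \<notin> int ` S \<and> (\<forall>x\<in>S. x \<noteq> 0 \<longrightarrow> z + int x \<in> int ` S)}"

definition minimal_generating_set :: "nat set \<Rightarrow> nat set \<Rightarrow> bool" where
  "minimal_generating_set S A \<longleftrightarrow> generated A = S \<and> (\<forall>B. B \<subset> A \<longrightarrow> generated B \<noteq> S)"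

text \<open>A numerical semigroup has exactly one minimal generating set, and it is finite; hence the
  strictly increasing list \<open>ns\<close> of minimal generators below is determined by \<open>S\<close>.
  Matrix and list indices start at 0.\<close>

definition row_factorization_matrices :: "nat set \<Rightarrow> int \<Rightarrow> int mat set" where
  "row_factorization_matrices S f =
     {M. f \<in> pseudo_frobenius S \<and>
         (\<exists>ns. sorted_wrt (<) ns \<and> minimal_generating_set S (set ns) \<and>
            M \<in> carrier_mat (length ns) (length ns) \<and>
            (\<forall>i<length ns.
               M $$ (i, i) = -1 \<and>
               (\<forall>j<length ns. j \<noteq> i \<longrightarrow> M $$ (i, j) \<ge> 0) \<and>
               f = (\<Sum>j<length ns. M $$ (i, j) * int (ns ! j))))}"

end

theory Submission
  imports Defs
begin

text \<open>Write \<open>s = 5 k\<close> with \<open>k \<ge> 1\<close>. The semigroup consists of the multiples of 5 and of all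
  numbers from \<open>s\<close> on (\<open>semigroup_eq\<close>). The last four gaps are pseudo-Frobenius numbers, because
  adding any nonzero element leads beyond \<open>s\<close>; every other integer outside the semigroup is kept
  outside by adding 5 or by adding \<open>s + 1\<close> (\<open>pseudo_frobenius_eq\<close>).

  None of the five given generators is a sum of two nonzero elements, so they are the only minimal
  generating set (\<open>minimal_generating_set_unique\<close>). A row-factorization matrix of \<open>f\<close> is then an
  independent choice of rows (\<open>row_factorization_matrices_eq_rows\<close>), where row \<open>i\<close> amounts to a
  factorization of \<open>f + n\<^sub>i\<close> without the generator \<open>n\<^sub>i\<close>.

  For \<open>f \<le> s - 1\<close> and \<open>n\<^sub>i \<le> s + 4\<close> we have \<open>f + n\<^sub>i \<le> 10 k + 3\<close>. Three of the large generators
  \<open>5 k + 1, ..., 5 k + 4\<close> add up to at least \<open>15 k + 3\<close>, so at most two of them occur in a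
  factorization. With at most one, the residue modulo 5 determines
  everything; with two, only \<open>2 (5 k + 1) = 10 k + 2\<close> and \<open>(5 k + 1) + (5 k + 2) = 10 k + 3\<close> are
  small enough (\<open>small_factorization_cases\<close>). The value \<open>10 k + 2\<close> is reached for \<open>f = s - 2\<close> in the
  last row and for \<open>f = s - 1\<close> in the fourth row, the value \<open>10 k + 3\<close> only for \<open>f = s - 1\<close> in the
  last row. At these places there are two rows, and everywhere else there is exactly one, which
  gives \<open>1, 1, 2, 4\<close> matrices.\<close>

section \<open>Row-factorization matrices are assembled from independent rows\<close>

text \<open>The numbers of matrices are obtained by counting lists of rows. The rows need
  length \<open>n\<close>, because the matrix does not see list entries beyond its last column.\<close>

lemma mat_of_rows_list_inject:
  assumes eq: "mat_of_rows_list n rs = mat_of_rows_list n rs'"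
    and len: "\<forall>r\<in>set rs. length r = n" "\<forall>r\<in>set rs'. length r = n"
  shows "rs = rs'"
proof (rule nth_equalityI)
  show l: "length rs = length rs'"
    using arg_cong[OF eq, of dim_row] by (simp add: mat_of_rows_list_def)
  fix i assume i: "i < length rs"
  show "rs ! i = rs' ! i"
  proof (rule nth_equalityI)
    show "length (rs ! i) = length (rs' ! i)"
      using len i l by simp
    fix j assume "j < length (rs ! i)"
    then show "rs ! i ! j = rs' ! i ! j"
      using arg_cong[OF eq, of "\<lambda>M. M $$ (i, j)"] i l len
      by (simp add: mat_of_rows_list_def)
  qed
qed

definition factorization_rows :: "nat list \<Rightarrow> int \<Rightarrow> nat \<Rightarrow> int list set" where
  "factorization_rows ns f i =
     {r. length r = length ns \<and> r ! i = -1 \<and> (\<forall>j<length ns. j \<noteq> i \<longrightarrow> r ! j \<ge> 0) \<and>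
         f = (\<Sum>j<length ns. r ! j * int (ns ! j))}"

text \<open>The defining condition constrains each row separately, so the set of matrices is a product of
  sets of rows. Uniqueness of the minimal generating set fixes the list of generators, which
  is existentially quantified in the definition.\<close>

lemma row_factorization_matrices_eq_rows:
  assumes f: "f \<in> pseudo_frobenius S"
    and ns: "\<And>A. minimal_generating_set S A \<longleftrightarrow> A = set ns" "sorted_wrt (<) ns"
  shows "row_factorization_matrices S f =
    {mat_of_rows_list (length ns) rs | rs.
       length rs = length ns \<and> (\<forall>i<length ns. rs ! i \<in> factorization_rows ns f i)}"
    (is "_ = ?R")
proof -
  have ns_unique: "ms = ns" if "sorted_wrt (<) ms" "minimal_generating_set S (set ms)" for ms
    using that ns strict_sorted_equal by metis
  show ?thesis
  proof (intro equalityI subsetI)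
    fix M assume "M \<in> row_factorization_matrices S f"
    then have M: "M \<in> carrier_mat (length ns) (length ns)"
      "\<forall>i<length ns. M $$ (i, i) = -1 \<and> (\<forall>j<length ns. j \<noteq> i \<longrightarrow> M $$ (i, j) \<ge> 0) \<and>
         f = (\<Sum>j<length ns. M $$ (i, j) * int (ns ! j))"
      unfolding row_factorization_matrices_def using ns_unique by blast+
    define rs where "rs = map (\<lambda>i. map (\<lambda>j. M $$ (i, j)) [0..<length ns]) [0..<length ns]"
    have "M = mat_of_rows_list (length ns) rs"
      using M(1) by (intro eq_matI) (auto simp: rs_def mat_of_rows_list_def)
    moreover have "rs ! i \<in> factorization_rows ns f i" if "i < length ns" for i
      using M(2) that by (auto simp: rs_def factorization_rows_def)
    ultimately show "M \<in> ?R" by (auto simp: rs_def)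
  next
    fix M assume "M \<in> ?R"
    then obtain rs where rs: "M = mat_of_rows_list (length ns) rs" "length rs = length ns"
      "\<forall>i<length ns. rs ! i \<in> factorization_rows ns f i"
      by blast
    have "M \<in> carrier_mat (length ns) (length ns)"
      using rs(1,2) by (auto simp: mat_of_rows_list_def)
    moreover have "M $$ (i, j) = rs ! i ! j" if "i < length ns" "j < length ns" for i j
      using rs(1,2) that by (simp add: mat_of_rows_list_def)
    ultimately show "M \<in> row_factorization_matrices S f"
      unfolding row_factorization_matrices_def using f ns rs(3)
      by (auto simp: factorization_rows_def intro!: exI[of _ ns])
  qed
qed

definition factorizations :: "nat list \<Rightarrow> int \<Rightarrow> int list set" where
  "factorizations ns N =
     {x. length x = length ns \<and> (\<forall>j<length ns. x ! j \<ge> 0) \<and>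
         N = (\<Sum>j<length ns. x ! j * int (ns ! j))}"

text \<open>The entry \<open>-1\<close> of a row is moved to the other side of its equation: row \<open>i\<close> is a
  factorization of \<open>f\<close> plus the \<open>i\<close>-th generator that does not involve that generator.\<close>

lemma factorization_rows_eq_factorizations:
  assumes i: "i < length ns"
  shows "factorization_rows ns f i =
    (\<lambda>x. x[i := -1]) ` {x \<in> factorizations ns (f + int (ns ! i)). x ! i = 0}"
proof -
  have split: "(\<Sum>j<length ns. y ! j * int (ns ! j)) =
      y ! i * int (ns ! i) + (\<Sum>j\<in>{..<length ns} - {i}. y ! j * int (ns ! j))" for y :: "int list"
    using i by (simp add: sum.remove)
  have others: "(\<Sum>j\<in>{..<length ns} - {i}. y[i := c] ! j * int (ns ! j)) =
      (\<Sum>j\<in>{..<length ns} - {i}. y ! j * int (ns ! j))" for y c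
    by (intro sum.cong) auto
  show ?thesis
  proof (intro equalityI subsetI)
    fix y assume "y \<in> factorization_rows ns f i"
    then have y: "length y = length ns" "y ! i = -1" "\<forall>j<length ns. j \<noteq> i \<longrightarrow> y ! j \<ge> 0"
      "f = (\<Sum>j<length ns. y ! j * int (ns ! j))"
      unfolding factorization_rows_def by auto
    have "y[i := 0] \<in> {x \<in> factorizations ns (f + int (ns ! i)). x ! i = 0}"
      using y i unfolding factorizations_def split others by (auto simp: nth_list_update)
    moreover have "y = (y[i := 0])[i := -1]"
      using y(2) by (metis list_update_id list_update_overwrite)
    ultimately show "y \<in> (\<lambda>x. x[i := -1]) ` {x \<in> factorizations ns (f + int (ns ! i)). x ! i = 0}"
      by (metis (no_types, lifting) imageI)
  next
    fix y assume "y \<in> (\<lambda>x. x[i := -1]) ` {x \<in> factorizations ns (f + int (ns ! i)). x ! i = 0}"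
    then obtain x where x: "y = x[i := -1]" "length x = length ns" "\<forall>j<length ns. x ! j \<ge> 0"
      "f + int (ns ! i) = (\<Sum>j<length ns. x ! j * int (ns ! j))" "x ! i = 0"
      unfolding factorizations_def by auto
    show "y \<in> factorization_rows ns f i"
      using x i unfolding factorization_rows_def x(1) split others by (auto simp: nth_list_update)
  qed
qed

section \<open>Generated submonoids and irreducible elements\<close>

lemma generatedI: "finite F \<Longrightarrow> F \<subseteq> A \<Longrightarrow> (\<Sum>a\<in>F. c a * a) \<in> generated A"
  unfolding generated_def by blast

lemma generated_zero: "0 \<in> generated A"
  using generatedI[of "{}" A] by simp

lemma generated_multiple: "a \<in> A \<Longrightarrow> m * a \<in> generated A"
  using generatedI[of "{a}" A "\<lambda>_. m"] by simp

lemma generated_superset: "a \<in> A \<Longrightarrow> a \<in> generated A"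
  using generated_multiple[of a A 1] by simp

lemma generated_add:
  assumes "x \<in> generated A" and "y \<in> generated A"
  shows "x + y \<in> generated A"
proof -
  obtain F c where F: "finite F" "F \<subseteq> A" "x = (\<Sum>a\<in>F. c a * a)"
    using assms(1) unfolding generated_def by blast
  obtain F' c' where F': "finite F'" "F' \<subseteq> A" "y = (\<Sum>a\<in>F'. c' a * a)"
    using assms(2) unfolding generated_def by blast
  define h where "h a = (if a \<in> F then c a else 0) + (if a \<in> F' then c' a else 0)" for a
  have x: "x = (\<Sum>a\<in>F \<union> F'. (if a \<in> F then c a else 0) * a)"
    unfolding F(3) using F(1) F'(1) by (intro sum.mono_neutral_cong_left) auto
  have y: "y = (\<Sum>a\<in>F \<union> F'. (if a \<in> F' then c' a else 0) * a)"
    unfolding F'(3) using F(1) F'(1) by (intro sum.mono_neutral_cong_left) auto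
  have "x + y = (\<Sum>a\<in>F \<union> F'. h a * a)"
    unfolding x y h_def sum.distrib[symmetric] by (simp only: distrib_right)
  then show ?thesis
    using generatedI[of "F \<union> F'" A h] F F' by simp
qed

lemma generated_least:
  assumes "A \<subseteq> T" and "0 \<in> T" and add: "\<And>x y. x \<in> T \<Longrightarrow> y \<in> T \<Longrightarrow> x + y \<in> T"
  shows "generated A \<subseteq> T"
proof
  fix x assume "x \<in> generated A"
  then obtain F c where F: "finite F" "F \<subseteq> A" "x = (\<Sum>a\<in>F. c a * a)"
    unfolding generated_def by blast
  have mult: "m * a \<in> T" if "a \<in> T" for m a
    using that by (induction m) (auto intro: add assms(2))
  have "(\<Sum>a\<in>F. c a * a) \<in> T"
    using F(1,2)
  proof (induction F rule: finite_induct)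
    case empty
    then show ?case using assms(2) by simp
  next
    case (insert a F)
    then show ?case using assms(1) by (auto intro!: add mult)
  qed
  then show "x \<in> T" using F(3) by simp
qed

text \<open>A nonzero element that is not a sum of two nonzero elements cannot be composed from other
  generators, so every generating set has to contain it: splitting one generator off a
  representation of \<open>x\<close> leaves a remainder in the monoid, which irreducibility forces to be 0.\<close>

lemma irreducible_in_generators:
  assumes x: "x \<in> generated A" "x \<noteq> 0"
    and irr: "\<And>y z. y \<in> generated A \<Longrightarrow> z \<in> generated A \<Longrightarrow> x = y + z \<Longrightarrow> y = 0 \<or> z = 0"
  shows "x \<in> A"
proof -
  obtain F c where F: "finite F" "F \<subseteq> A" "x = (\<Sum>a\<in>F. c a * a)"
    using x(1) unfolding generated_def by blast
  obtain a where a: "a \<in> F" "c a * a \<noteq> 0"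
    using F x(2) by (meson sum.neutral)
  obtain m where m: "c a = Suc m"
    using a(2) by (cases "c a") auto
  define z where "z = m * a + (\<Sum>b\<in>F - {a}. c b * b)"
  have "x = c a * a + (\<Sum>b\<in>F - {a}. c b * b)"
    using F a by (simp add: sum.remove)
  then have split: "x = a + z"
    by (simp add: m z_def)
  have "z \<in> generated A"
    unfolding z_def using F a
    by (intro generated_add generated_multiple generatedI) auto
  then have "a = 0 \<or> z = 0"
    using irr[of a z] split F a generated_superset by blast
  then show ?thesis
    using split a F by auto
qed

text \<open>Generators that are all irreducible lie in every generating set; so they form a generating set
  that is contained in each of the others, and no other one is minimal.\<close>

lemma minimal_generating_set_unique:
  assumes gen: "generated G = S"
    and nz: "0 \<notin> G"
    and irr: "\<And>g y z. g \<in> G \<Longrightarrow> y \<in> S \<Longrightarrow> z \<in> S \<Longrightarrow> g = y + z \<Longrightarrow> y = 0 \<or> z = 0"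
  shows "minimal_generating_set S A \<longleftrightarrow> A = G"
proof -
  have sub: "G \<subseteq> B" if B: "generated B = S" for B
  proof
    fix g assume g: "g \<in> G"
    show "g \<in> B"
    proof (rule irreducible_in_generators)
      show "g \<in> generated B" using g gen B generated_superset by blast
      show "g \<noteq> 0" using g nz by metis
      show "y = 0 \<or> z = 0" if "y \<in> generated B" "z \<in> generated B" "g = y + z" for y z
        using irr[OF g] that B by blast
    qed
  qed
  show ?thesis
    unfolding minimal_generating_set_def using sub gen by blast
qed

section \<open>The semigroup generated by 5, s + 1, ..., s + 4\<close>

lemma semigroup_eq:
  fixes s :: nat
  assumes "5 dvd s"
  shows "generated {5, s + 1, s + 2, s + 3, s + 4} = {x. 5 dvd x \<or> s \<le> x}"
    (is "generated ?G = ?T")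
proof
  show "generated ?G \<subseteq> ?T"
    by (rule generated_least) auto
  show "?T \<subseteq> generated ?G"
  proof
    fix x assume x: "x \<in> ?T"
    have mult: "5 * m \<in> generated ?G" for m
      using generated_multiple[of 5 ?G m] by (simp add: mult.commute)
    show "x \<in> generated ?G"
    proof (cases "5 dvd x")
      case True
      then show ?thesis using mult by blast
    next
      case False
      with x have "s \<le> x" by simp
      define r where "r = (x - s) mod 5"
      have eq: "x = (s + r) + 5 * ((x - s) div 5)"
        unfolding r_def using \<open>s \<le> x\<close> by simp
      have "r \<noteq> 0"
      proof
        assume "r = 0"
        with eq assms have "5 dvd x" by (metis add_0_right dvd_add dvd_triv_left)
        with False show False by simp
      qed
      moreover have "r < 5" by (simp add: r_def)
      ultimately have "r \<in> {1, 2, 3, 4}" by auto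
      then have "s + r \<in> ?G" by auto
      then show ?thesis
        by (subst eq) (intro generated_add mult generated_superset)
    qed
  qed
qed

text \<open>Nonzero elements are at least 5, and those that are not multiples of 5 exceed \<open>s\<close>. A sum
  of two nonzero elements is therefore at least 10, and at least \<open>s + 6\<close> unless it is a multiple
  of 5; so the five given generators are irreducible.\<close>

lemma minimal_generators_eq:
  fixes s :: nat
  assumes "5 dvd s" and "s \<ge> 5"
  shows "minimal_generating_set {x. 5 dvd x \<or> s \<le> x} A \<longleftrightarrow> A = {5, s + 1, s + 2, s + 3, s + 4}"
proof (rule minimal_generating_set_unique)
  show "generated {5, s + 1, s + 2, s + 3, s + 4} = {x. 5 dvd x \<or> s \<le> x}"
    by (rule semigroup_eq[OF assms(1)])
  show "0 \<notin> {5, s + 1, s + 2, s + 3, s + 4}" by simp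
next
  fix g y z
  assume g: "g \<in> {5, s + 1, s + 2, s + 3, s + 4}"
    and yz: "y \<in> {x. 5 dvd x \<or> s \<le> x}" "z \<in> {x. 5 dvd x \<or> s \<le> x}" and eq: "g = y + z"
  obtain k where k: "s = 5 * k" using assms(1) by blast
  have ge5: "x \<ge> 5" if "x \<in> {x. 5 dvd x \<or> s \<le> x}" "x \<noteq> 0" for x
    using that assms(2) by (auto dest: dvd_imp_le)
  show "y = 0 \<or> z = 0"
  proof (rule ccontr)
    assume "\<not> (y = 0 \<or> z = 0)"
    with ge5 yz have ge: "y \<ge> 5" "z \<ge> 5" by auto
    have "g \<noteq> 5" using ge eq by linarith
    with g have gs: "s < g" "g \<le> s + 4" by auto
    then have "\<not> 5 dvd g" unfolding k by presburger
    with eq have "\<not> 5 dvd y \<or> \<not> 5 dvd z" by auto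
    with yz have "s \<le> y \<or> s \<le> z" by auto
    with ge eq gs show False by linarith
  qed
qed

text \<open>Adding 5 to an integer \<open>z\<close> outside the semigroup reaches it only if \<open>z > s - 5\<close> or \<open>z\<close> is a
  negative multiple of 5; adding \<open>s + 1\<close> excludes the latter, because the result would be at most
  \<open>s - 4\<close> and not a multiple of 5.\<close>

lemma pseudo_frobenius_eq:
  fixes s :: nat
  assumes "5 dvd s" and "s \<ge> 5"
  shows "pseudo_frobenius {x. 5 dvd x \<or> s \<le> x} = {int s - 4, int s - 3, int s - 2, int s - 1}"
    (is "pseudo_frobenius ?S = _")
proof -
  obtain k where k: "s = 5 * k" using assms(1) by blast
  then have int_s: "int s = 5 * int k" by simp
  have mem: "z \<in> int ` ?S \<longleftrightarrow> z \<ge> 0 \<and> (5 dvd z \<or> int s \<le> z)" for z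
  proof
    assume "z \<in> int ` ?S"
    then obtain x where "x \<in> ?S" "z = int x" by blast
    then show "z \<ge> 0 \<and> (5 dvd z \<or> int s \<le> z)" by auto
  next
    assume z: "z \<ge> 0 \<and> (5 dvd z \<or> int s \<le> z)"
    then have "nat z \<in> ?S" by auto presburger
    moreover have "z = int (nat z)" using z by simp
    ultimately show "z \<in> int ` ?S" by blast
  qed
  show ?thesis
  proof (intro equalityI subsetI)
    fix z assume "z \<in> pseudo_frobenius ?S"
    then have z: "z \<notin> int ` ?S" "\<And>x. x \<in> ?S \<Longrightarrow> x \<noteq> 0 \<Longrightarrow> z + int x \<in> int ` ?S"
      unfolding pseudo_frobenius_def by auto
    have "z + 5 \<in> int ` ?S" and "z + (int s + 1) \<in> int ` ?S"
      using z(2)[of 5] z(2)[of "s + 1"] by (simp_all add: ac_simps)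
    then have z5: "z + 5 \<ge> 0" "5 dvd z + 5 \<or> int s \<le> z + 5"
      and zs: "5 dvd z + (int s + 1) \<or> int s \<le> z + (int s + 1)"
      and notin: "\<not> (z \<ge> 0 \<and> (5 dvd z \<or> int s \<le> z))"
      using z(1) unfolding mem by auto
    have not_dvd: "\<not> 5 dvd z"
    proof
      assume dvd: "5 dvd z"
      then have "\<not> 5 dvd z + (int s + 1)" using int_s by presburger
      with zs have "z \<ge> -1" by linarith
      moreover have "z < 0" using notin dvd by linarith
      ultimately have "z = -1" by linarith
      with dvd show False by simp
    qed
    then have "\<not> 5 dvd z + 5" by presburger
    with z5 have "int s - 5 \<le> z" by linarith
    moreover have "z \<noteq> int s - 5" using not_dvd int_s by presburger
    moreover have "z < int s" using notin int_s by linarith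
    ultimately have "int s - 5 < z \<and> z < int s" by linarith
    then show "z \<in> {int s - 4, int s - 3, int s - 2, int s - 1}" by auto
  next
    fix z assume z: "z \<in> {int s - 4, int s - 3, int s - 2, int s - 1}"
    have "z = 5 * int k - 4 \<or> z = 5 * int k - 3 \<or> z = 5 * int k - 2 \<or> z = 5 * int k - 1"
      using z int_s by simp
    then have "z \<notin> int ` ?S" unfolding mem int_s by presburger
    moreover have "z + int x \<in> int ` ?S" if x: "x \<in> ?S" "x \<noteq> 0" for x
    proof -
      have "x \<ge> 5" using x assms(2) by (auto dest: dvd_imp_le)
      then show ?thesis unfolding mem using z by auto
    qed
    ultimately show "z \<in> pseudo_frobenius ?S" unfolding pseudo_frobenius_def by blast
  qed
qed

section \<open>Factorizations of small elements\<close>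

text \<open>Three large generators exceed the bound because \<open>15 k + 3 > 10 k + 3\<close>. If there are two,
  the bound leaves less than 5 beyond \<open>10 k\<close>, hence no copy of 5, and their offsets add up to at
  most 3: they are \<open>1 + 1\<close> or \<open>1 + 2\<close>.\<close>

lemma small_factorization_cases:
  fixes k a b c d e N :: int
  assumes nonneg: "a \<ge> 0" "b \<ge> 0" "c \<ge> 0" "d \<ge> 0" "e \<ge> 0" and "k \<ge> 1"
    and eq: "N = a * 5 + b * (5 * k + 1) + c * (5 * k + 2) + d * (5 * k + 3) + e * (5 * k + 4)"
    and small: "N \<le> 10 * k + 3"
  shows "N = 5 * a \<and> b = 0 \<and> c = 0 \<and> d = 0 \<and> e = 0 \<or>
    N = 5 * a + 5 * k + 1 \<and> b = 1 \<and> c = 0 \<and> d = 0 \<and> e = 0 \<or>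
    N = 5 * a + 5 * k + 2 \<and> b = 0 \<and> c = 1 \<and> d = 0 \<and> e = 0 \<or>
    N = 5 * a + 5 * k + 3 \<and> b = 0 \<and> c = 0 \<and> d = 1 \<and> e = 0 \<or>
    N = 5 * a + 5 * k + 4 \<and> b = 0 \<and> c = 0 \<and> d = 0 \<and> e = 1 \<or>
    N = 10 * k + 2 \<and> a = 0 \<and> b = 2 \<and> c = 0 \<and> d = 0 \<and> e = 0 \<or>
    N = 10 * k + 3 \<and> a = 0 \<and> b = 1 \<and> c = 1 \<and> d = 0 \<and> e = 0"
proof -
  define t where "t = b + c + d + e"
  have N: "N = 5 * a + 5 * (k * t) + (b + 2 * c + 3 * d + 4 * e)"
    unfolding eq t_def by (simp add: algebra_simps)
  have "t \<le> 2"
  proof (rule ccontr)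
    assume "\<not> t \<le> 2"
    then have "k * 3 \<le> k * t" using \<open>k \<ge> 1\<close> by (intro mult_left_mono) auto
    moreover have "t \<le> b + 2 * c + 3 * d + 4 * e" using nonneg unfolding t_def by linarith
    ultimately show False using N small nonneg \<open>k \<ge> 1\<close> \<open>\<not> t \<le> 2\<close> by linarith
  qed
  moreover have "t \<ge> 0" using nonneg unfolding t_def by linarith
  ultimately consider "t = 0" | "t = 1" | "t = 2" by linarith
  then show ?thesis
  proof cases
    case 1
    then have "b = 0 \<and> c = 0 \<and> d = 0 \<and> e = 0"
      using nonneg unfolding t_def by (intro conjI; linarith)
    moreover from this have "N = 5 * a" using N 1 by simp
    ultimately show ?thesis by blast
  next
    case 2
    then have one: "b = 1 \<or> c = 1 \<or> d = 1 \<or> e = 1"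
      using nonneg unfolding t_def by linarith
    have sum1: "b + c + d + e = 1" using 2 unfolding t_def .
    have N': "N = 5 * a + 5 * k + (b + 2 * c + 3 * d + 4 * e)" using N 2 by simp
    show ?thesis
      using one
    proof (elim disjE)
      assume "b = 1"
      moreover have "c = 0" "d = 0" "e = 0" using \<open>b = 1\<close> sum1 nonneg(3-5) by linarith+
      ultimately show ?thesis using N' by simp
    next
      assume "c = 1"
      moreover have "b = 0" "d = 0" "e = 0" using \<open>c = 1\<close> sum1 nonneg(2,4,5) by linarith+
      ultimately show ?thesis using N' by simp
    next
      assume "d = 1"
      moreover have "b = 0" "c = 0" "e = 0" using \<open>d = 1\<close> sum1 nonneg(2,3,5) by linarith+
      ultimately show ?thesis using N' by simp
    next
      assume "e = 1"
      moreover have "b = 0" "c = 0" "d = 0" using \<open>e = 1\<close> sum1 nonneg(2-4) by linarith+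
      ultimately show ?thesis using N' by simp
    qed
  next
    case 3
    then have sum2: "b + c + d + e = 2" unfolding t_def .
    from N 3 have N': "N = 5 * a + 10 * k + (b + 2 * c + 3 * d + 4 * e)" by simp
    have de: "d = 0" "e = 0" "a = 0" using N' small nonneg sum2 by linarith+
    have "c = 0 \<or> c = 1" using N' small nonneg sum2 by linarith
    then show ?thesis
    proof
      assume "c = 0"
      with sum2 de have "b = 2" by simp
      with \<open>c = 0\<close> de N' show ?thesis by simp
    next
      assume "c = 1"
      with sum2 de have "b = 1" by simp
      with \<open>c = 1\<close> de N' show ?thesis by simp
    qed
  qed
qed

lemma list_of_length_5: "length r = 5 \<longleftrightarrow> (\<exists>a b c d e. r = [a, b, c, d, e])"
  by (auto simp: length_Suc_conv eval_nat_numeral)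

text \<open>Parametrizing by \<open>k = s div 5\<close> keeps the residues modulo 5 of all quantities visible
  to linear arithmetic.\<close>

definition generator_list :: "nat \<Rightarrow> nat list" where
  "generator_list k = [5, 5 * k + 1, 5 * k + 2, 5 * k + 3, 5 * k + 4]"

lemma all_less_5: "(\<forall>j<5. P j) \<longleftrightarrow> P 0 \<and> P 1 \<and> P 2 \<and> P 3 \<and> P (4 :: nat)"
  by (auto simp: numeral_eq_Suc All_less_Suc)

text \<open>The candidates for factorizations of a number \<open>5 q + r \<le> 10 k + 3\<close>. The first one has
  at most one large generator, namely the one that the residue \<open>r\<close> determines; its number of copies of 5
  may be negative, in which case it is not a factorization. The candidates with two large generators
  occur only at \<open>10 k + 2\<close> and \<open>10 k + 3\<close>.\<close>

definition small_factorizations :: "nat \<Rightarrow> int \<Rightarrow> nat \<Rightarrow> int list set" where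
  "small_factorizations k q r =
     {if r = 0 then [q, 0, 0, 0, 0] else [q - int k, 0, 0, 0, 0][r := 1]} \<union>
     (if q = 2 * int k \<and> r = 2 then {[0, 2, 0, 0, 0]} else {}) \<union>
     (if q = 2 * int k \<and> r = 3 then {[0, 1, 1, 0, 0]} else {})"

lemma factorizations_generators:
  "[a, b, c, d, e] \<in> factorizations (generator_list k) N \<longleftrightarrow>
    a \<ge> 0 \<and> b \<ge> 0 \<and> c \<ge> 0 \<and> d \<ge> 0 \<and> e \<ge> 0 \<and>
    N = a * 5 + b * (5 * int k + 1) + c * (5 * int k + 2) + d * (5 * int k + 3) + e * (5 * int k + 4)"
proof -
  have five: "{..<5} = {0, 1, 2, 3, 4 :: nat}" by auto
  have len: "length (generator_list k) = 5" by (simp add: generator_list_def)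
  show ?thesis
    unfolding factorizations_def len
    by (simp add: all_less_5 five generator_list_def ac_simps)
qed

lemma factorizations_small:
  assumes k: "k \<ge> 1" and r: "r < 5" and N: "N = 5 * q + int r" and small: "N \<le> 10 * int k + 3"
  shows "factorizations (generator_list k) N = {x \<in> small_factorizations k q r. x ! 0 \<ge> 0}"
proof (intro equalityI subsetI)
  fix x assume x: "x \<in> factorizations (generator_list k) N"
  then have "length x = 5" by (simp add: factorizations_def generator_list_def)
  then obtain a b c d e where abcde: "x = [a, b, c, d, e]" unfolding list_of_length_5 by blast
  have nonneg: "a \<ge> 0" "b \<ge> 0" "c \<ge> 0" "d \<ge> 0" "e \<ge> 0" and eq:
    "N = a * 5 + b * (5 * int k + 1) + c * (5 * int k + 2) + d * (5 * int k + 3) + e * (5 * int k + 4)"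
    using x unfolding abcde factorizations_generators by auto
  have "int k \<ge> 1" using k by simp
  note cases = small_factorization_cases[OF nonneg this eq small]
  \<comment> \<open>Two representations with quotient and remainder by 5 agree.\<close>
  have unique: "q = m \<and> int r = n" if "N = 5 * m + n" "0 \<le> n" "n < 5" for m n
  proof -
    have "N div 5 = q" "N mod 5 = int r" using N r by simp_all
    moreover have "N div 5 = m" "N mod 5 = n" using that by simp_all
    ultimately show ?thesis by simp
  qed
  from cases show "x \<in> {x \<in> small_factorizations k q r. x ! 0 \<ge> 0}"
  proof (elim disjE conjE)
    assume *: "N = 5 * a" "b = 0" "c = 0" "d = 0" "e = 0"
    then have "q = a \<and> int r = 0" by (intro unique) simp_all
    with * nonneg show ?thesis by (simp add: abcde small_factorizations_def)
  next
    assume *: "N = 5 * a + 5 * int k + 1" "b = 1" "c = 0" "d = 0" "e = 0"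
    then have "q = a + int k \<and> int r = 1" by (intro unique) simp_all
    with * nonneg show ?thesis by (simp add: abcde small_factorizations_def)
  next
    assume *: "N = 5 * a + 5 * int k + 2" "b = 0" "c = 1" "d = 0" "e = 0"
    then have "q = a + int k \<and> int r = 2" by (intro unique) simp_all
    with * nonneg show ?thesis by (simp add: abcde small_factorizations_def)
  next
    assume *: "N = 5 * a + 5 * int k + 3" "b = 0" "c = 0" "d = 1" "e = 0"
    then have "q = a + int k \<and> int r = 3" by (intro unique) simp_all
    with * nonneg show ?thesis by (simp add: abcde small_factorizations_def)
  next
    assume *: "N = 5 * a + 5 * int k + 4" "b = 0" "c = 0" "d = 0" "e = 1"
    then have "q = a + int k \<and> int r = 4" by (intro unique) simp_all
    with * nonneg show ?thesis by (simp add: abcde small_factorizations_def)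
  next
    assume *: "N = 10 * int k + 2" "a = 0" "b = 2" "c = 0" "d = 0" "e = 0"
    then have "q = 2 * int k \<and> int r = 2" by (intro unique) simp_all
    with * nonneg show ?thesis by (simp add: abcde small_factorizations_def)
  next
    assume *: "N = 10 * int k + 3" "a = 0" "b = 1" "c = 1" "d = 0" "e = 0"
    then have "q = 2 * int k \<and> int r = 3" by (intro unique) simp_all
    with * nonneg show ?thesis by (simp add: abcde small_factorizations_def)
  qed
next
  fix x assume x: "x \<in> {x \<in> small_factorizations k q r. x ! 0 \<ge> 0}"
  have "r = 0 \<or> r = 1 \<or> r = 2 \<or> r = 3 \<or> r = 4" using r by linarith
  then show "x \<in> factorizations (generator_list k) N"
    using x unfolding N
    by (elim disjE) (auto simp: small_factorizations_def factorizations_generators split: if_splits)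
qed

lemma factorization_rows_small:
  assumes k: "k \<ge> 1" and i: "i < 5" and r: "r < 5"
    and eq: "f + int (generator_list k ! i) = 5 * q + int r" and small: "5 * q + int r \<le> 10 * int k + 3"
  shows "factorization_rows (generator_list k) f i =
    (\<lambda>x. x[i := -1]) ` {x \<in> small_factorizations k q r. x ! 0 \<ge> 0 \<and> x ! i = 0}"
proof -
  have len: "i < length (generator_list k)" using i by (simp add: generator_list_def)
  have "factorization_rows (generator_list k) f i =
      (\<lambda>x. x[i := -1]) ` {x \<in> {x \<in> small_factorizations k q r. x ! 0 \<ge> 0}. x ! i = 0}"
    unfolding factorization_rows_eq_factorizations[OF len]
      factorizations_small[OF k r eq small[folded eq]] by (rule refl)
  then show ?thesis by (simp only: mem_Collect_eq conj_assoc)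
qed

lemma nth_copies_of_5: "0 < i \<Longrightarrow> i < 5 \<Longrightarrow> [a, 0, 0, 0, 0] ! i = (0 :: int)"
  by (auto simp: numeral_eq_Suc less_Suc_eq)

lemma generator_list_nth: "0 < i \<Longrightarrow> i < 5 \<Longrightarrow> generator_list k ! i = 5 * k + i"
  by (auto simp: generator_list_def numeral_eq_Suc less_Suc_eq)

text \<open>Counting from 0, the generators are \<open>n\<^sub>0 = 5\<close> and \<open>n\<^sub>i = 5 k + i\<close>. For \<open>f = 5 k - m\<close>
  the sum \<open>f + n\<^sub>i\<close> is thus \<open>5 k + (5 - m)\<close> for \<open>i = 0\<close> and \<open>10 k + (i - m)\<close> otherwise. Its
  quotient by 5 is \<open>2 k - 1\<close> for \<open>0 < i < m\<close> and \<open>2 k\<close> for \<open>i \<ge> m\<close>; in the latter range the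
  remainder is \<open>i - m\<close>, and a second row appears where it is 2 or 3.\<close>

lemma factorization_rows_pattern:
  assumes k: "k \<ge> 1" and m: "1 \<le> m" "m \<le> 4"
  defines "R \<equiv> factorization_rows (generator_list k) (5 * int k - int m)"
  shows "R 0 = {[-1, 0, 0, 0, 0][5 - m := 1]}"
    and "1 \<le> i \<Longrightarrow> i < m \<Longrightarrow> R i = {[int k - 1, 0, 0, 0, 0][5 + i - m := 1, i := -1]}"
    and "R m = {[2 * int k, 0, 0, 0, 0][m := -1]}"
    and "m < i \<Longrightarrow> i < 5 \<Longrightarrow> R i =
      {[int k, 0, 0, 0, 0][i - m := 1, i := -1]} \<union>
      (if i = m + 2 then {[0, 2, 0, 0, 0][i := -1]} else {}) \<union>
      (if i = m + 3 then {[0, 1, 1, 0, 0][i := -1]} else {})"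
proof -
  have k1: "int k \<ge> 1" using k by simp
  have single: "(\<lambda>x. x[i := -1]) ` {x \<in> {y}. P x} = {y[i := -1]}" if "P y" for i P and y :: "int list"
    using that by auto
  have suc: "5 - m = Suc (4 - m)" using m by simp
  have "R 0 = (\<lambda>x. x[0 := -1]) `
      {x \<in> small_factorizations k (int k) (5 - m). x ! 0 \<ge> 0 \<and> x ! 0 = 0}"
    unfolding R_def using m k1
    by (intro factorization_rows_small k) (simp_all add: generator_list_def of_nat_diff)
  also have "small_factorizations k (int k) (5 - m) = {[0, 0, 0, 0, 0][5 - m := 1]}"
    using m k1 by (simp add: small_factorizations_def)
  finally show "R 0 = {[-1, 0, 0, 0, 0][5 - m := 1]}"
    using m by (subst (asm) single) (simp_all add: suc)
  show "R i = {[int k - 1, 0, 0, 0, 0][5 + i - m := 1, i := -1]}" if i: "1 \<le> i" "i < m"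
  proof -
    have "R i = (\<lambda>x. x[i := -1]) `
        {x \<in> small_factorizations k (2 * int k - 1) (5 + i - m). x ! 0 \<ge> 0 \<and> x ! i = 0}"
      unfolding R_def using m i k1
      by (intro factorization_rows_small k) (simp_all add: generator_list_nth of_nat_diff)
    also have "small_factorizations k (2 * int k - 1) (5 + i - m) =
        {[int k - 1, 0, 0, 0, 0][5 + i - m := 1]}"
      using m i by (simp add: small_factorizations_def)
    finally show ?thesis
      using m i k1 by (subst (asm) single) (simp_all add: nth_list_update nth_copies_of_5 del: list_update.simps nth_Cons_pos)
  qed
  have "R m = (\<lambda>x. x[m := -1]) ` {x \<in> small_factorizations k (2 * int k) 0. x ! 0 \<ge> 0 \<and> x ! m = 0}"
    unfolding R_def using m k1
    by (intro factorization_rows_small k) (simp_all add: generator_list_nth)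
  also have "small_factorizations k (2 * int k) 0 = {[2 * int k, 0, 0, 0, 0]}"
    by (simp add: small_factorizations_def)
  finally show "R m = {[2 * int k, 0, 0, 0, 0][m := -1]}"
    using m by (subst (asm) single) (simp_all add: nth_copies_of_5 del: nth_Cons_pos)
  show "R i = {[int k, 0, 0, 0, 0][i - m := 1, i := -1]} \<union>
      (if i = m + 2 then {[0, 2, 0, 0, 0][i := -1]} else {}) \<union>
      (if i = m + 3 then {[0, 1, 1, 0, 0][i := -1]} else {})" if i: "m < i" "i < 5"
  proof -
    have "R i = (\<lambda>x. x[i := -1]) `
        {x \<in> small_factorizations k (2 * int k) (i - m). x ! 0 \<ge> 0 \<and> x ! i = 0}"
      unfolding R_def using m i k1
      by (intro factorization_rows_small k) (simp_all add: generator_list_nth of_nat_diff)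
    also have "small_factorizations k (2 * int k) (i - m) =
        {[int k, 0, 0, 0, 0][i - m := 1]} \<union> (if i = m + 2 then {[0, 2, 0, 0, 0]} else {}) \<union>
        (if i = m + 3 then {[0, 1, 1, 0, 0]} else {})" (is "_ = ?F")
      using i by (auto simp: small_factorizations_def)
    also have "{x \<in> ?F. x ! 0 \<ge> 0 \<and> x ! i = 0} = ?F"
    proof -
      have "[int k, 0, 0, 0, 0][i - m := 1] ! 0 \<ge> 0" "[int k, 0, 0, 0, 0][i - m := 1] ! i = 0"
        using m i by (simp_all add: nth_list_update nth_copies_of_5 del: list_update.simps nth_Cons_pos)
      moreover have "i = 3 \<or> i = 4" if "i = m + 2" using that m i by linarith
      then have "[0, 2, 0, 0, 0] ! i = (0 :: int)" if "i = m + 2" using that by fastforce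
      moreover have "[0, 1, 1, 0, 0] ! i = (0 :: int)" if "i = m + 3"
      proof -
        have "i = 4" using that m i by linarith
        then show ?thesis by simp
      qed
      ultimately show ?thesis by auto
    qed
    finally show ?thesis by (simp add: image_Un)
  qed
qed

lemma factorization_rows_minus_four:
  assumes "k \<ge> 1"
  shows
    "factorization_rows (generator_list k) (5 * int k - 4) 0 = {[-1, 1, 0, 0, 0]}"
    "factorization_rows (generator_list k) (5 * int k - 4) 1 = {[int k - 1, -1, 1, 0, 0]}"
    "factorization_rows (generator_list k) (5 * int k - 4) 2 = {[int k - 1, 0, -1, 1, 0]}"
    "factorization_rows (generator_list k) (5 * int k - 4) 3 = {[int k - 1, 0, 0, -1, 1]}"
    "factorization_rows (generator_list k) (5 * int k - 4) 4 = {[2 * int k, 0, 0, 0, -1]}"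
proof -
  note pattern = factorization_rows_pattern[OF assms]
  show "factorization_rows (generator_list k) (5 * int k - 4) 0 = {[-1, 1, 0, 0, 0]}"
    using pattern(1)[of 4] by simp
  show "factorization_rows (generator_list k) (5 * int k - 4) 1 = {[int k - 1, -1, 1, 0, 0]}"
    using pattern(2)[of 4 1] by simp
  show "factorization_rows (generator_list k) (5 * int k - 4) 2 = {[int k - 1, 0, -1, 1, 0]}"
    using pattern(2)[of 4 2] by simp
  show "factorization_rows (generator_list k) (5 * int k - 4) 3 = {[int k - 1, 0, 0, -1, 1]}"
    using pattern(2)[of 4 3] by simp
  show "factorization_rows (generator_list k) (5 * int k - 4) 4 = {[2 * int k, 0, 0, 0, -1]}"
    using pattern(3)[of 4] by simp
qed

lemma factorization_rows_minus_three:
  assumes "k \<ge> 1"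
  shows
    "factorization_rows (generator_list k) (5 * int k - 3) 0 = {[-1, 0, 1, 0, 0]}"
    "factorization_rows (generator_list k) (5 * int k - 3) 1 = {[int k - 1, -1, 0, 1, 0]}"
    "factorization_rows (generator_list k) (5 * int k - 3) 2 = {[int k - 1, 0, -1, 0, 1]}"
    "factorization_rows (generator_list k) (5 * int k - 3) 3 = {[2 * int k, 0, 0, -1, 0]}"
    "factorization_rows (generator_list k) (5 * int k - 3) 4 = {[int k, 1, 0, 0, -1]}"
proof -
  note pattern = factorization_rows_pattern[OF assms]
  show "factorization_rows (generator_list k) (5 * int k - 3) 0 = {[-1, 0, 1, 0, 0]}"
    using pattern(1)[of 3] by simp
  show "factorization_rows (generator_list k) (5 * int k - 3) 1 = {[int k - 1, -1, 0, 1, 0]}"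
    using pattern(2)[of 3 1] by simp
  show "factorization_rows (generator_list k) (5 * int k - 3) 2 = {[int k - 1, 0, -1, 0, 1]}"
    using pattern(2)[of 3 2] by simp
  show "factorization_rows (generator_list k) (5 * int k - 3) 3 = {[2 * int k, 0, 0, -1, 0]}"
    using pattern(3)[of 3] by simp
  show "factorization_rows (generator_list k) (5 * int k - 3) 4 = {[int k, 1, 0, 0, -1]}"
    using pattern(4)[of 3 4] by simp
qed

lemma factorization_rows_minus_two:
  assumes "k \<ge> 1"
  shows
    "factorization_rows (generator_list k) (5 * int k - 2) 0 = {[-1, 0, 0, 1, 0]}"
    "factorization_rows (generator_list k) (5 * int k - 2) 1 = {[int k - 1, -1, 0, 0, 1]}"
    "factorization_rows (generator_list k) (5 * int k - 2) 2 = {[2 * int k, 0, -1, 0, 0]}"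
    "factorization_rows (generator_list k) (5 * int k - 2) 3 = {[int k, 1, 0, -1, 0]}"
    "factorization_rows (generator_list k) (5 * int k - 2) 4 = {[int k, 0, 1, 0, -1], [0, 2, 0, 0, -1]}"
proof -
  note pattern = factorization_rows_pattern[OF assms]
  show "factorization_rows (generator_list k) (5 * int k - 2) 0 = {[-1, 0, 0, 1, 0]}"
    using pattern(1)[of 2] by simp
  show "factorization_rows (generator_list k) (5 * int k - 2) 1 = {[int k - 1, -1, 0, 0, 1]}"
    using pattern(2)[of 2 1] by simp
  show "factorization_rows (generator_list k) (5 * int k - 2) 2 = {[2 * int k, 0, -1, 0, 0]}"
    using pattern(3)[of 2] by simp
  show "factorization_rows (generator_list k) (5 * int k - 2) 3 = {[int k, 1, 0, -1, 0]}"
    using pattern(4)[of 2 3] by simp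
  show "factorization_rows (generator_list k) (5 * int k - 2) 4 = {[int k, 0, 1, 0, -1], [0, 2, 0, 0, -1]}"
    using pattern(4)[of 2 4] by (simp add: insert_commute)
qed

lemma factorization_rows_minus_one:
  assumes "k \<ge> 1"
  shows
    "factorization_rows (generator_list k) (5 * int k - 1) 0 = {[-1, 0, 0, 0, 1]}"
    "factorization_rows (generator_list k) (5 * int k - 1) 1 = {[2 * int k, -1, 0, 0, 0]}"
    "factorization_rows (generator_list k) (5 * int k - 1) 2 = {[int k, 1, -1, 0, 0]}"
    "factorization_rows (generator_list k) (5 * int k - 1) 3 = {[int k, 0, 1, -1, 0], [0, 2, 0, -1, 0]}"
    "factorization_rows (generator_list k) (5 * int k - 1) 4 = {[int k, 0, 0, 1, -1], [0, 1, 1, 0, -1]}"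
proof -
  note pattern = factorization_rows_pattern[OF assms]
  show "factorization_rows (generator_list k) (5 * int k - 1) 0 = {[-1, 0, 0, 0, 1]}"
    using pattern(1)[of 1] by simp
  show "factorization_rows (generator_list k) (5 * int k - 1) 1 = {[2 * int k, -1, 0, 0, 0]}"
    using pattern(3)[of 1] by simp
  show "factorization_rows (generator_list k) (5 * int k - 1) 2 = {[int k, 1, -1, 0, 0]}"
    using pattern(4)[of 1 2] by simp
  show "factorization_rows (generator_list k) (5 * int k - 1) 3 = {[int k, 0, 1, -1, 0], [0, 2, 0, -1, 0]}"
    using pattern(4)[of 1 3] by (simp add: insert_commute)
  show "factorization_rows (generator_list k) (5 * int k - 1) 4 = {[int k, 0, 0, 1, -1], [0, 1, 1, 0, -1]}"
    using pattern(4)[of 1 4] by (simp add: insert_commute)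
qed

section \<open>Pseudo-Frobenius numbers and row-factorization matrices\<close>

abbreviation five_semigroup :: "nat \<Rightarrow> nat set" where
  "five_semigroup k \<equiv> {x. 5 dvd x \<or> 5 * k \<le> x}"

lemma pseudo_frobenius_five_semigroup:
  assumes "k \<ge> 1"
  shows "pseudo_frobenius (five_semigroup k) = {5 * int k - 4, 5 * int k - 3, 5 * int k - 2, 5 * int k - 1}"
  using pseudo_frobenius_eq[of "5 * k"] assms by simp

lemma minimal_generators_five_semigroup:
  assumes "k \<ge> 1"
  shows "minimal_generating_set (five_semigroup k) A \<longleftrightarrow> A = set (generator_list k)"
  using minimal_generators_eq[of "5 * k" A] assms by (simp add: generator_list_def)

lemma matrices_eq_five_rows:
  assumes k: "k \<ge> 1" and f: "f \<in> pseudo_frobenius (five_semigroup k)"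
  shows "row_factorization_matrices (five_semigroup k) f =
      {mat_of_rows_list 5 [r1, r2, r3, r4, r5] | r1 r2 r3 r4 r5.
         r1 \<in> factorization_rows (generator_list k) f 0 \<and>
         r2 \<in> factorization_rows (generator_list k) f 1 \<and>
         r3 \<in> factorization_rows (generator_list k) f 2 \<and>
         r4 \<in> factorization_rows (generator_list k) f 3 \<and>
         r5 \<in> factorization_rows (generator_list k) f 4}"
proof -
  have len: "length (generator_list k) = 5" by (simp add: generator_list_def)
  have sorted: "sorted_wrt (<) (generator_list k)" using k by (simp add: generator_list_def)
  show ?thesis
    unfolding row_factorization_matrices_eq_rows[OF f minimal_generators_five_semigroup[OF k] sorted]
      len list_of_length_5 all_less_5
    by (intro Collect_cong) force
qed

lemma matrices_minus_four:
  assumes k: "k \<ge> 1"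
  shows "row_factorization_matrices (five_semigroup k) (5 * int k - 4) =
      {mat_of_rows_list 5
        [[-1, 1, 0, 0, 0],
         [int k - 1, -1, 1, 0, 0],
         [int k - 1, 0, -1, 1, 0],
         [int k - 1, 0, 0, -1, 1],
         [2 * int k, 0, 0, 0, -1]]}"
proof -
  have f: "5 * int k - 4 \<in> pseudo_frobenius (five_semigroup k)"
    unfolding pseudo_frobenius_five_semigroup[OF k] by blast
  show ?thesis
    unfolding matrices_eq_five_rows[OF k f] factorization_rows_minus_four[OF k] by blast
qed

lemma matrices_minus_three:
  assumes k: "k \<ge> 1"
  shows "row_factorization_matrices (five_semigroup k) (5 * int k - 3) =
      {mat_of_rows_list 5
        [[-1, 0, 1, 0, 0],
         [int k - 1, -1, 0, 1, 0],
         [int k - 1, 0, -1, 0, 1],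
         [2 * int k, 0, 0, -1, 0],
         [int k, 1, 0, 0, -1]]}"
proof -
  have f: "5 * int k - 3 \<in> pseudo_frobenius (five_semigroup k)"
    unfolding pseudo_frobenius_five_semigroup[OF k] by blast
  show ?thesis
    unfolding matrices_eq_five_rows[OF k f] factorization_rows_minus_three[OF k] by blast
qed

lemma matrices_minus_two:
  assumes k: "k \<ge> 1"
  shows "row_factorization_matrices (five_semigroup k) (5 * int k - 2) =
      {mat_of_rows_list 5
        [[-1, 0, 0, 1, 0],
         [int k - 1, -1, 0, 0, 1],
         [2 * int k, 0, -1, 0, 0],
         [int k, 1, 0, -1, 0],
         r5] | r5. r5 \<in> {[int k, 0, 1, 0, -1], [0, 2, 0, 0, -1]}}"
proof -
  have f: "5 * int k - 2 \<in> pseudo_frobenius (five_semigroup k)"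
    unfolding pseudo_frobenius_five_semigroup[OF k] by blast
  show ?thesis
    unfolding matrices_eq_five_rows[OF k f] factorization_rows_minus_two[OF k] by blast
qed

lemma matrices_minus_one:
  assumes k: "k \<ge> 1"
  shows "row_factorization_matrices (five_semigroup k) (5 * int k - 1) =
      {mat_of_rows_list 5
        [[-1, 0, 0, 0, 1],
         [2 * int k, -1, 0, 0, 0],
         [int k, 1, -1, 0, 0],
         r4,
         r5] | r4 r5.
        r4 \<in> {[int k, 0, 1, -1, 0], [0, 2, 0, -1, 0]} \<and>
        r5 \<in> {[int k, 0, 0, 1, -1], [0, 1, 1, 0, -1]}}"
proof -
  have f: "5 * int k - 1 \<in> pseudo_frobenius (five_semigroup k)"
    unfolding pseudo_frobenius_five_semigroup[OF k] by blast
  show ?thesis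
    unfolding matrices_eq_five_rows[OF k f] factorization_rows_minus_one[OF k] by blast
qed

lemma five_rows_inject:
  assumes "\<forall>r\<in>set rs. length r = 5" "\<forall>r\<in>set rs'. length r = 5"
  shows "mat_of_rows_list 5 rs = mat_of_rows_list 5 rs' \<longleftrightarrow> rs = rs'"
  using mat_of_rows_list_inject[OF _ assms] by blast

lemma card_matrices_minus_two:
  assumes "k \<ge> 1"
  shows "card (row_factorization_matrices (five_semigroup k) (5 * int k - 2)) = 2"
proof -
  have "{F r5 | r5. r5 \<in> {a, b}} = {F a, F b}" for F :: "int list \<Rightarrow> int mat" and a b
    by blast
  then show ?thesis
    unfolding matrices_minus_two[OF assms] by (simp add: five_rows_inject)
qed

lemma card_matrices_minus_one:
  assumes "k \<ge> 1"
  shows "card (row_factorization_matrices (five_semigroup k) (5 * int k - 1)) = 4"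
proof -
  have "{F r4 r5 | r4 r5. r4 \<in> {a, b} \<and> r5 \<in> {c, d}} = {F a c, F a d, F b c, F b d}"
    for F :: "int list \<Rightarrow> int list \<Rightarrow> int mat" and a b c d
    by blast
  then show ?thesis
    unfolding matrices_minus_one[OF assms] by (simp add: five_rows_inject)
qed

theorem proposition3p7:
  fixes S :: "nat set" and s :: nat
  assumes "numerical_semigroup S"
    and "arf S"
    and "semigroup_multiplicity S = 5"
    and "conductor S = int s"
    and "s \<ge> 5"
    and "s mod 5 = 0"
    and "S = generated {5, s + 1, s + 2, s + 3, s + 4}"
  shows "pseudo_frobenius S = {int s - 4, int s - 3, int s - 2, int s - 1} \<and>
    row_factorization_matrices S (int s - 4) =
      {mat_of_rows_list 5
        [[-1, 1, 0, 0, 0],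
         [(int s - 5) div 5, -1, 1, 0, 0],
         [(int s - 5) div 5, 0, -1, 1, 0],
         [(int s - 5) div 5, 0, 0, -1, 1],
         [2 * int s div 5, 0, 0, 0, -1]]} \<and>
    row_factorization_matrices S (int s - 3) =
      {mat_of_rows_list 5
        [[-1, 0, 1, 0, 0],
         [(int s - 5) div 5, -1, 0, 1, 0],
         [(int s - 5) div 5, 0, -1, 0, 1],
         [2 * int s div 5, 0, 0, -1, 0],
         [int s div 5, 1, 0, 0, -1]]} \<and>
    row_factorization_matrices S (int s - 2) =
      {mat_of_rows_list 5
        [[-1, 0, 0, 1, 0],
         [(int s - 5) div 5, -1, 0, 0, 1],
         [2 * int s div 5, 0, -1, 0, 0],
         [int s div 5, 1, 0, -1, 0],
         r5] | r5.
        r5 \<in> {[int s div 5, 0, 1, 0, -1], [0, 2, 0, 0, -1]}} \<and>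
    card (row_factorization_matrices S (int s - 2)) = 2 \<and>
    row_factorization_matrices S (int s - 1) =
      {mat_of_rows_list 5
        [[-1, 0, 0, 0, 1],
         [2 * int s div 5, -1, 0, 0, 0],
         [int s div 5, 1, -1, 0, 0],
         r4,
         r5] | r4 r5.
        r4 \<in> {[int s div 5, 0, 1, -1, 0], [0, 2, 0, -1, 0]} \<and>
        r5 \<in> {[int s div 5, 0, 0, 1, -1], [0, 1, 1, 0, -1]}} \<and>
    card (row_factorization_matrices S (int s - 1)) = 4"
proof -
  obtain k where s: "s = 5 * k" using assms(6) by (auto simp: mod_eq_0_iff_dvd)
  have k: "k \<ge> 1" using assms(5) s by simp
  have dvd: "5 dvd s" using s by simp
  have "S = {x. 5 dvd x \<or> s \<le> x}" by (rule trans[OF assms(7) semigroup_eq[OF dvd]])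
  then have S: "S = five_semigroup k" unfolding s .
  have int_s: "int s = 5 * int k" using s by simp
  have quotients: "(5 * int k - 5) div 5 = int k - 1" "5 * int k div 5 = int k"
    "2 * (5 * int k) div 5 = 2 * int k"
    by auto
  show ?thesis
    unfolding S int_s quotients
    by (intro conjI pseudo_frobenius_five_semigroup matrices_minus_four matrices_minus_three
        matrices_minus_two matrices_minus_one card_matrices_minus_two card_matrices_minus_one k)
qed

end
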